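(* Let $X$ be a normed linear space, $m\ge2$, let $\mathbf{\Omega}=\{\Omega_1,\ldots,\Omega_m\}$ be a collection of subsets of $X$, and let $\bar x\in\bigcap_{i=1}^m\Omega_i$. Define the set-valued mapping $F:X\rightrightarrows X^m$ by $$F(x):=(\Omega_1-x)\times\cdots\times(\Omega_m-x),\qquad x\in X.$$ (i) $\mathbf{\Omega}$ is semiregular at $\bar x$ if and only if $F$ is metrically semiregular at $(\bar x,0)$. Moreover, $\theta[\mathbf{\Omega}](\bar x)=\theta[F](\bar x,0)$. (ii) $\mathbf{\Omega}$ is subregular at $\bar x$ if and only if $F$ is metrically subregular at $(\bar x,0)$. Moreover, $\zeta[\mathbf{\Omega}](\bar x)=\zeta[F](\bar x,0)$. (iii) $\mathbf{\Omega}$ is uniformly regular at $\bar x$ if and only if $F$ is metrically regular at $(\bar x,0)$. Moreover, $\hat\theta[\mathbf{\Omega}](\bar x)=\hat\theta[F](\bar x,0)$.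
   Context: Product spaces carry the maximum norm. $\mathbb{B}$ denotes the closed unit ball, $B_\delta(\cdot)$ a closed ball of radius $\delta$, $d(x,\Omega)=\inf_{\omega\in\Omega}\|x-\omega\|$ with $d(x,\emptyset)=+\infty$. Regularity of a set-valued mapping $F:X\rightrightarrows Y$ at $(\bar x,\bar y)$ with $\bar y\in F(\bar x)$, where $F^{-1}(y)=\{x:y\in F(x)\}$: - metrically semiregular: there are $\gamma,\delta>0$ with $\gamma d(\bar x,F^{-1}(y))\le d(y,\bar y)$ for all $y\in B_\delta(\bar y)$; - metrically subregular: there are $\gamma,\delta>0$ with $\gamma d(x,F^{-1}(\bar y))\le d(\bar y,F(x))$ for all $x\in B_\delta(\bar x)$; - metrically regular: there are $\gamma,\delta>0$ with $\gamma d(x,F^{-1}(y))\le d(y,F(x))$ for all $(x,y)\in B_\delta(\bar x,\bar y)$. The exact upper bounds (in $[0,+\infty]$) of all $\gamma$ such that the respective property holds (for some $\delta>0$) are denoted $\theta[F](\bar x,\bar y)$, $\zeta[F](\bar x,\bar y)$, $\hat\theta[F](\bar x,\bar y)$ respectively (equal to $0$ if no positive $\gamma$ works). Regularity of $\mathbf{\Omega}$ at $\bar x$: - semiregular: there exist $\alpha,\delta>0$ such that $\bigcap_{i=1}^m(\Omega_i-x_i)\cap B_\rho(\bar x)\ne\emptyset$ for all $\rho\in]0,\delta[$ and all $x_i\in X$ with $\max_i\|x_i\|\le\alpha\rho$; - subregular: there exist $\alpha,\delta>0$ such that $\bigcap_{i=1}^m(\Omega_i+(\alpha\rho)\mathbb{B})\cap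 B_\delta(\bar x)\subseteq(\bigcap_{i=1}^m\Omega_i)+\rho\mathbb{B}$ for all $\rho\in]0,\delta[$; - uniformly regular: there exist $\alpha,\delta>0$ such that $\bigcap_{i=1}^m(\Omega_i-\omega_i-x_i)\cap(\rho\mathbb{B})\ne\emptyset$ for all $\rho\in]0,\delta[$, $\omega_i\in\Omega_i\cap B_\delta(\bar x)$, and $x_i\in X$ with $\max_i\|x_i\|\le\alpha\rho$. Constants: for $\rho,\delta>0$, $$\theta_\rho[\mathbf{\Omega}](\bar x):=\sup\Big\{r\ge0:\ \bigcap_{i=1}^m(\Omega_i-x_i)\cap B_\rho(\bar x)\ne\emptyset\ \ \forall x_i\in r\mathbb{B}\Big\},$$ $$\zeta_{\rho,\delta}[\mathbf{\Omega}](\bar x):=\sup\Big\{r\ge0:\ \bigcap_{i=1}^m(\Omega_i+r\mathbb{B})\cap B_\delta(\bar x)\subseteq\bigcap_{i=1}^m\Omega_i+\rho\mathbb{B}\Big\},$$ $$\theta[\mathbf{\Omega}](\bar x):=\liminf_{\rho\downarrow0}\frac{\theta_\rho[\mathbf{\Omega}](\bar x)}{\rho},\quad \zeta[\mathbf{\Omega}](\bar x):=\lim_{\delta\downarrow0}\inf_{0<\rho<\delta}\frac{\zeta_{\rho,\delta}[\mathbf{\Omega}](\bar x)}{\rho},$$ $$\hat\theta[\mathbf{\Omega}](\bar x):=\liminf_{\omega_i\to\bar x,\ \omega_i\in\Omega_i,\ \rho\downarrow0}\frac{\theta_\rho[\Omega_1-\omega_1,\ldots,\Omega_m-\omega_m](0)}{\rho}.$$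 *)

theory Defs
  imports "HOL-Analysis.Analysis"
begin

text \<open>The power \<open>X\<^sup>m\<close> with the maximum norm. The index type \<open>'m\<close> has \<open>m\<close> elements. A type of its
  own is needed because \<open>'a ^ 'm\<close> carries the Euclidean norm.\<close>

typedef ('a, 'm) max_pow = "UNIV :: ('m \<Rightarrow> 'a) set"
  morphisms coord tuple ..

lemma coord_tuple [simp]: "coord (tuple f) = f"
  by (simp add: tuple_inverse)

lemma max_pow_eq_iff: "x = y \<longleftrightarrow> (\<forall>i. coord x i = coord y i)"
  by (metis coord_inject ext)

instantiation max_pow :: (real_normed_vector, finite) real_normed_vector
begin

definition zero_max_pow_def: "(0 :: ('a, 'b) max_pow) = tuple (\<lambda>_. 0)"
definition plus_max_pow_def: "x + y = tuple (\<lambda>i. coord x i + coord y i)" for x y :: "('a, 'b) max_pow"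
definition minus_max_pow_def: "x - y = tuple (\<lambda>i. coord x i - coord y i)" for x y :: "('a, 'b) max_pow"
definition uminus_max_pow_def: "- x = tuple (\<lambda>i. - coord x i)" for x :: "('a, 'b) max_pow"
definition scaleR_max_pow_def: "c *\<^sub>R x = tuple (\<lambda>i. c *\<^sub>R coord x i)" for x :: "('a, 'b) max_pow"
definition norm_max_pow_def: "norm x = (MAX i. norm (coord x i))" for x :: "('a, 'b) max_pow"
definition dist_max_pow_def: "dist x y = norm (x - y)" for x y :: "('a, 'b) max_pow"
definition sgn_max_pow_def: "sgn x = inverse (norm x) *\<^sub>R x" for x :: "('a, 'b) max_pow"
definition uniformity_max_pow_def:
  "(uniformity :: (('a, 'b) max_pow \<times> ('a, 'b) max_pow) filter) =
    (INF e\<in>{0<..}. principal {(x, y). dist x y < e})"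
definition open_max_pow_def:
  "open (U :: ('a, 'b) max_pow set) \<longleftrightarrow>
    (\<forall>x\<in>U. \<forall>\<^sub>F (x', y) in uniformity. x' = x \<longrightarrow> y \<in> U)"

instance
proof
  fix x y z :: "('a, 'b) max_pow" and a b :: real
  note vec_defs = zero_max_pow_def plus_max_pow_def minus_max_pow_def uminus_max_pow_def
    scaleR_max_pow_def
  have coord_le: "norm (coord w i) \<le> norm w" for w :: "('a, 'b) max_pow" and i
    unfolding norm_max_pow_def by (rule Max_ge) auto
  have norm_le: "norm w \<le> r \<longleftrightarrow> (\<forall>i. norm (coord w i) \<le> r)" for w :: "('a, 'b) max_pow" and r
    unfolding norm_max_pow_def by (subst Max_le_iff) auto
  show "x + y + z = x + (y + z)" "x + y = y + x" "0 + x = x" "- x + x = 0" "x - y = x + - y"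
    "a *\<^sub>R (x + y) = a *\<^sub>R x + a *\<^sub>R y" "(a + b) *\<^sub>R x = a *\<^sub>R x + b *\<^sub>R x"
    "a *\<^sub>R b *\<^sub>R x = (a * b) *\<^sub>R x" "1 *\<^sub>R x = x"
    by (simp_all add: max_pow_eq_iff vec_defs algebra_simps)
  show "dist x y = norm (x - y)" "sgn x = inverse (norm x) *\<^sub>R x"
    "(uniformity :: (('a, 'b) max_pow \<times> ('a, 'b) max_pow) filter) =
      (INF e\<in>{0<..}. principal {(x, y). dist x y < e})"
    "open U \<longleftrightarrow> (\<forall>x\<in>U. \<forall>\<^sub>F (x', y) in uniformity. x' = x \<longrightarrow> y \<in> U)"
    for U :: "('a, 'b) max_pow set"
    by (fact dist_max_pow_def sgn_max_pow_def uniformity_max_pow_def open_max_pow_def)+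
  have ge0: "0 \<le> norm w" for w :: "('a, 'b) max_pow"
    using coord_le[of w undefined] norm_ge_zero order_trans by blast
  show "(norm x = 0) = (x = 0)"
  proof -
    have "norm x = 0 \<longleftrightarrow> norm x \<le> 0" using ge0[of x] by auto
    also have "\<dots> \<longleftrightarrow> x = 0" by (simp add: norm_le max_pow_eq_iff zero_max_pow_def)
    finally show ?thesis .
  qed
  show "norm (x + y) \<le> norm x + norm y"
    unfolding norm_le plus_max_pow_def
    by (auto intro!: norm_triangle_le add_mono coord_le)
  have scale_le: "norm (c *\<^sub>R w) \<le> \<bar>c\<bar> * norm w" for c and w :: "('a, 'b) max_pow"
    unfolding norm_le[of "c *\<^sub>R w"]
    by (auto simp: scaleR_max_pow_def intro!: mult_left_mono coord_le)
  show "norm (a *\<^sub>R x) = \<bar>a\<bar> * norm x"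
  proof (cases "a = 0")
    case True
    then show ?thesis using scale_le[of a x] ge0[of "a *\<^sub>R x"] by simp
  next
    case False
    have "x = inverse a *\<^sub>R (a *\<^sub>R x)"
      using False by (simp add: max_pow_eq_iff scaleR_max_pow_def)
    then have "norm x \<le> \<bar>inverse a\<bar> * norm (a *\<^sub>R x)"
      using scale_le[of "inverse a" "a *\<^sub>R x"] by simp
    then have "\<bar>a\<bar> * norm x \<le> norm (a *\<^sub>R x)"
      using False by (simp add: field_simps)
    then show ?thesis using scale_le[of a x] by simp
  qed
qed

end

text \<open>The library's \<open>infdist\<close> is 0 on the empty set; here the value is \<open>\<infinity>\<close>.\<close>

definition set_dist :: "'a::metric_space \<Rightarrow> 'a set \<Rightarrow> ennreal" where
  "set_dist x A = (INF a\<in>A. ennreal (dist x a))"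


subsection \<open>Set-valued mappings\<close>

definition preimage :: "('a \<Rightarrow> 'b set) \<Rightarrow> 'b \<Rightarrow> 'a set" where
  "preimage F y = {x. y \<in> F x}"

definition semiregular_with ::
  "('a::metric_space \<Rightarrow> 'b::metric_space set) \<Rightarrow> 'a \<Rightarrow> 'b \<Rightarrow> real \<Rightarrow> bool" where
  "semiregular_with F xb yb \<gamma> \<longleftrightarrow>
    (\<exists>\<delta>>0. \<forall>y\<in>cball yb \<delta>. ennreal \<gamma> * set_dist xb (preimage F y) \<le> ennreal (dist y yb))"

definition subregular_with ::
  "('a::metric_space \<Rightarrow> 'b::metric_space set) \<Rightarrow> 'a \<Rightarrow> 'b \<Rightarrow> real \<Rightarrow> bool" where
  "subregular_with F xb yb \<gamma> \<longleftrightarrow>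
    (\<exists>\<delta>>0. \<forall>x\<in>cball xb \<delta>. ennreal \<gamma> * set_dist x (preimage F yb) \<le> set_dist yb (F x))"

text \<open>A closed ball of the maximum metric on \<open>X \<times> Y\<close> is a product of balls. The library's metric
  on product types is Euclidean.\<close>

definition regular_with ::
  "('a::metric_space \<Rightarrow> 'b::metric_space set) \<Rightarrow> 'a \<Rightarrow> 'b \<Rightarrow> real \<Rightarrow> bool" where
  "regular_with F xb yb \<gamma> \<longleftrightarrow>
    (\<exists>\<delta>>0. \<forall>x\<in>cball xb \<delta>. \<forall>y\<in>cball yb \<delta>.
      ennreal \<gamma> * set_dist x (preimage F y) \<le> set_dist y (F x))"

definition metrically_semiregular where
  "metrically_semiregular F xb yb \<longleftrightarrow> (\<exists>\<gamma>>0. semiregular_with F xb yb \<gamma>)"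

definition metrically_subregular where
  "metrically_subregular F xb yb \<longleftrightarrow> (\<exists>\<gamma>>0. subregular_with F xb yb \<gamma>)"

definition metrically_regular where
  "metrically_regular F xb yb \<longleftrightarrow> (\<exists>\<gamma>>0. regular_with F xb yb \<gamma>)"

text \<open>In \<^typ>\<open>ennreal\<close> the supremum of the empty set is 0, as required when no \<open>\<gamma> > 0\<close> works.\<close>

definition semiregularity_modulus ::
  "('a::metric_space \<Rightarrow> 'b::metric_space set) \<Rightarrow> 'a \<Rightarrow> 'b \<Rightarrow> ennreal" where
  "semiregularity_modulus F xb yb = (SUP \<gamma>\<in>{\<gamma>. \<gamma> > 0 \<and> semiregular_with F xb yb \<gamma>}. ennreal \<gamma>)"

definition subregularity_modulus ::
  "('a::metric_space \<Rightarrow> 'b::metric_space set) \<Rightarrow> 'a \<Rightarrow> 'b \<Rightarrow> ennreal" where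
  "subregularity_modulus F xb yb = (SUP \<gamma>\<in>{\<gamma>. \<gamma> > 0 \<and> subregular_with F xb yb \<gamma>}. ennreal \<gamma>)"

definition regularity_modulus ::
  "('a::metric_space \<Rightarrow> 'b::metric_space set) \<Rightarrow> 'a \<Rightarrow> 'b \<Rightarrow> ennreal" where
  "regularity_modulus F xb yb = (SUP \<gamma>\<in>{\<gamma>. \<gamma> > 0 \<and> regular_with F xb yb \<gamma>}. ennreal \<gamma>)"


subsection \<open>Collections of sets\<close>

text \<open>The translate \<open>A - x\<close>; the operator \<open>-\<close> on sets is set difference. In contrast, \<open>+\<close> between
  sets below is the Minkowski sum of \<^theory>\<open>HOL-Library.Set_Algebras\<close>.\<close>

definition shift :: "'a::ab_group_add set \<Rightarrow> 'a \<Rightarrow> 'a set" where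
  "shift A x = (\<lambda>a. a - x) ` A"

definition semiregular :: "('m::finite \<Rightarrow> 'a::real_normed_vector set) \<Rightarrow> 'a \<Rightarrow> bool" where
  "semiregular \<Omega> xb \<longleftrightarrow>
    (\<exists>\<alpha>>0. \<exists>\<delta>>0. \<forall>\<rho>\<in>{0<..<\<delta>}. \<forall>x. (MAX i. norm (x i)) \<le> \<alpha> * \<rho> \<longrightarrow>
      (\<Inter>i. shift (\<Omega> i) (x i)) \<inter> cball xb \<rho> \<noteq> {})"

definition subregular :: "('m::finite \<Rightarrow> 'a::real_normed_vector set) \<Rightarrow> 'a \<Rightarrow> bool" where
  "subregular \<Omega> xb \<longleftrightarrow>
    (\<exists>\<alpha>>0. \<exists>\<delta>>0. \<forall>\<rho>\<in>{0<..<\<delta>}.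
      (\<Inter>i. \<Omega> i + cball 0 (\<alpha> * \<rho>)) \<inter> cball xb \<delta> \<subseteq> (\<Inter>i. \<Omega> i) + cball 0 \<rho>)"

definition uniformly_regular :: "('m::finite \<Rightarrow> 'a::real_normed_vector set) \<Rightarrow> 'a \<Rightarrow> bool" where
  "uniformly_regular \<Omega> xb \<longleftrightarrow>
    (\<exists>\<alpha>>0. \<exists>\<delta>>0. \<forall>\<rho>\<in>{0<..<\<delta>}. \<forall>\<omega> x. (\<forall>i. \<omega> i \<in> \<Omega> i \<inter> cball xb \<delta>) \<longrightarrow>
      (MAX i. norm (x i)) \<le> \<alpha> * \<rho> \<longrightarrow>
      (\<Inter>i. shift (shift (\<Omega> i) (\<omega> i)) (x i)) \<inter> cball 0 \<rho> \<noteq> {})"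

definition theta_at ::
  "('m::finite \<Rightarrow> 'a::real_normed_vector set) \<Rightarrow> 'a \<Rightarrow> real \<Rightarrow> ennreal" where
  "theta_at \<Omega> xb \<rho> =
    (SUP r\<in>{r. r \<ge> 0 \<and> (\<forall>x. (\<forall>i. x i \<in> cball 0 r) \<longrightarrow>
      (\<Inter>i. shift (\<Omega> i) (x i)) \<inter> cball xb \<rho> \<noteq> {})}. ennreal r)"

definition zeta_at ::
  "('m::finite \<Rightarrow> 'a::real_normed_vector set) \<Rightarrow> 'a \<Rightarrow> real \<Rightarrow> real \<Rightarrow> ennreal" where
  "zeta_at \<Omega> xb \<rho> \<delta> =
    (SUP r\<in>{r. r \<ge> 0 \<and>
      (\<Inter>i. \<Omega> i + cball 0 r) \<inter> cball xb \<delta> \<subseteq> (\<Inter>i. \<Omega> i) + cball 0 \<rho>}. ennreal r)"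

definition theta :: "('m::finite \<Rightarrow> 'a::real_normed_vector set) \<Rightarrow> 'a \<Rightarrow> ennreal" where
  "theta \<Omega> xb = Liminf (at_right 0) (\<lambda>\<rho>. theta_at \<Omega> xb \<rho> / ennreal \<rho>)"

definition zeta :: "('m::finite \<Rightarrow> 'a::real_normed_vector set) \<Rightarrow> 'a \<Rightarrow> ennreal" where
  "zeta \<Omega> xb = Lim (at_right 0) (\<lambda>\<delta>. INF \<rho>\<in>{0<..<\<delta>}. zeta_at \<Omega> xb \<rho> \<delta> / ennreal \<rho>)"

text \<open>The points \<open>\<omega>\<^sub>i \<rightarrow> xb\<close> in \<open>\<Omega>\<^sub>i\<close> may equal \<open>xb\<close>, hence \<open>nhds\<close> and not \<open>at _ within _\<close>.\<close>

definition theta_hat :: "('m::finite \<Rightarrow> 'a::real_normed_vector set) \<Rightarrow> 'a \<Rightarrow> ennreal" where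
  "theta_hat \<Omega> xb =
    Liminf (inf (nhds (tuple (\<lambda>_. xb))) (principal {\<omega>. \<forall>i. coord \<omega> i \<in> \<Omega> i}) \<times>\<^sub>F at_right 0)
      (\<lambda>(\<omega>, \<rho>). theta_at (\<lambda>i. shift (\<Omega> i) (coord \<omega> i)) 0 \<rho> / ennreal \<rho>)"

definition shift_map ::
  "('m::finite \<Rightarrow> 'a::real_normed_vector set) \<Rightarrow> 'a \<Rightarrow> ('a, 'm) max_pow set" where
  "shift_map \<Omega> x = {y. \<forall>i. coord y i \<in> shift (\<Omega> i) x}"

end

theory Submission
  imports Defs
begin

text \<open>Since \<open>F\<^sup>-\<^sup>1(y) = \<Inter>\<^sub>i (\<Omega>\<^sub>i - y\<^sub>i)\<close>, every property of the collection with constant \<open>\<alpha>\<close> says that a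
  distance to \<open>F\<^sup>-\<^sup>1(y)\<close> is at most \<open>\<rho>\<close> once some \<open>y\<close> or \<open>y - z\<close> with \<open>z \<in> F(x)\<close> has norm at most
  \<open>\<alpha>\<rho>\<close>. Choosing \<open>\<rho>\<close> to be that norm divided by \<open>\<alpha>\<close> gives the property of \<open>F\<close> with the same constant.
  Conversely, the property of \<open>F\<close> with \<open>\<gamma>\<close> gives the one of the collection with every \<open>\<alpha> < \<gamma>\<close>; the
  gap is needed because the distance need not be attained. Hence the exact bounds coincide.\<close>

section \<open>Membership in translates and enlargements, and the maximum norm\<close>

lemma mem_shift_iff: "p \<in> shift A x \<longleftrightarrow> p + x \<in> A"
proof
  assume "p + x \<in> A"
  then have "(p + x) - x \<in> shift A x" unfolding shift_def by (rule imageI)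
  then show "p \<in> shift A x" by simp
qed (auto simp: shift_def)

lemma shifts_meet_cball_iff:
  "(\<Inter>i. shift (\<Omega> i) (x i)) \<inter> cball c \<rho> \<noteq> {} \<longleftrightarrow> (\<exists>p. dist c p \<le> \<rho> \<and> (\<forall>i. p + x i \<in> \<Omega> i))"
  unfolding ex_in_conv[symmetric] by (auto simp: mem_shift_iff)

lemma mem_plus_cball_iff:
  fixes A :: "'a::real_normed_vector set"
  shows "x \<in> A + cball 0 r \<longleftrightarrow> (\<exists>a\<in>A. dist x a \<le> r)"
proof
  assume "\<exists>a\<in>A. dist x a \<le> r"
  then obtain a where a: "a \<in> A" "dist x a \<le> r" by blast
  then have "a + (x - a) \<in> A + cball 0 r"
    by (intro set_plus_intro) (simp_all add: dist_norm norm_minus_commute)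
  then show "x \<in> A + cball 0 r" by simp
qed (force simp: set_plus_def dist_norm)

lemma MAX_le_iff:
  fixes f :: "'m::finite \<Rightarrow> real"
  shows "(MAX i. f i) \<le> r \<longleftrightarrow> (\<forall>i. f i \<le> r)"
  by (subst Max_le_iff) auto

lemma norm_max_pow_le_iff: "norm y \<le> r \<longleftrightarrow> (\<forall>i. norm (coord y i) \<le> r)"
  unfolding norm_max_pow_def by (rule MAX_le_iff)

lemma norm_coord_le: "norm (coord y i) \<le> norm y"
  using norm_max_pow_le_iff[of y "norm y"] by simp

lemma coord_zero [simp]: "coord 0 i = 0"
  by (simp add: zero_max_pow_def)

lemma coord_diff [simp]: "coord (x - y) i = coord x i - coord y i"
  by (simp add: minus_max_pow_def)

lemma mem_shift_map_iff: "y \<in> shift_map \<Omega> x \<longleftrightarrow> (\<forall>i. x + coord y i \<in> \<Omega> i)"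
  by (simp add: shift_map_def mem_shift_iff add.commute)

lemma mem_preimage_shift_map_iff: "x \<in> preimage (shift_map \<Omega>) y \<longleftrightarrow> (\<forall>i. x + coord y i \<in> \<Omega> i)"
  by (simp add: preimage_def mem_shift_map_iff)

section \<open>Distances, quotients and suprema in \<open>ennreal\<close>\<close>

lemma mult_set_dist_leI:
  assumes "0 < \<gamma>" "a \<in> A" "\<gamma> * dist x a \<le> s"
  shows "ennreal \<gamma> * set_dist x A \<le> ennreal s"
proof -
  have "set_dist x A \<le> ennreal (dist x a)"
    unfolding set_dist_def by (rule INF_lower[OF assms(2)])
  then have "ennreal \<gamma> * set_dist x A \<le> ennreal \<gamma> * ennreal (dist x a)"
    by (rule mult_left_mono) simp
  also have "\<dots> \<le> ennreal s"
    using assms by (simp add: ennreal_mult[symmetric] ennreal_leI)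
  finally show ?thesis .
qed

text \<open>The infimum that defines the distance need not be attained, so a point within
  \<open>\<rho>\<close> is found only after the constant is lowered to \<open>\<gamma>'\<close>.
  Were all points of \<open>A\<close> farther away, the distance would be at least
  \<open>\<rho>\<close>, whence \<open>\<gamma> * \<rho> \<le> \<gamma>' * \<rho>\<close>. The same
  argument rules out an empty \<open>A\<close>, whose distance is infinite.\<close>

lemma mult_set_dist_leE:
  assumes "ennreal \<gamma> * set_dist x A \<le> ennreal (\<gamma>' * \<rho>)" "0 < \<gamma>'" "\<gamma>' < \<gamma>" "0 < \<rho>"
  obtains a where "a \<in> A" "dist x a \<le> \<rho>"
proof (rule ccontr)
  assume "\<not> thesis"
  then have "ennreal \<rho> \<le> set_dist x A"
    unfolding set_dist_def using that by (intro INF_greatest ennreal_leI) force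
  then have "ennreal \<gamma> * ennreal \<rho> \<le> ennreal \<gamma> * set_dist x A"
    by (rule mult_left_mono) simp
  also note assms(1)
  finally have "ennreal (\<gamma> * \<rho>) \<le> ennreal (\<gamma>' * \<rho>)"
    using assms by (simp add: ennreal_mult)
  then show False using assms by (simp add: ennreal_le_iff)
qed

lemma ennreal_le_divideI:
  assumes "ennreal (c * \<rho>) \<le> t" "0 < \<rho>" "0 \<le> c"
  shows "ennreal c \<le> t / ennreal \<rho>"
proof -
  have "ennreal c = ennreal (c * \<rho>) / ennreal \<rho>"
    using assms by (simp add: divide_ennreal)
  then show ?thesis using assms(1) by (simp add: divide_right_mono_ennreal)
qed

lemma ennreal_less_divideD:
  assumes "ennreal c < t / ennreal \<rho>" "0 < \<rho>" "0 \<le> c"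
  shows "ennreal (c * \<rho>) < t"
proof (rule ccontr)
  assume "\<not> ?thesis"
  then have "t / ennreal \<rho> \<le> ennreal (c * \<rho>) / ennreal \<rho>"
    by (simp add: divide_right_mono_ennreal)
  also have "\<dots> = ennreal c" using assms by (simp add: divide_ennreal)
  finally show False using assms(1) by simp
qed

text \<open>\<open>Lim\<close> is a definite description, so convergence has to be shown first. One
  point \<open>b\<close> with \<open>l < f b\<close> forces \<open>l < f x\<close> for all
  \<open>x\<close> between \<open>a\<close> and \<open>b\<close>, and no value exceeds the supremum.
  This serves to replace the limit in \<open>zeta\<close> by a supremum.\<close>

lemma Lim_at_right_antimono:
  fixes f :: "real \<Rightarrow> 'b::{complete_linorder, linorder_topology}"
  assumes "\<And>x y. \<lbrakk>a < x; x \<le> y\<rbrakk> \<Longrightarrow> f y \<le> f x"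
  shows "Lim (at_right a) f = (SUP x\<in>{a<..}. f x)"
proof (rule tendsto_Lim)
  show "(f \<longlongrightarrow> (SUP x\<in>{a<..}. f x)) (at_right a)"
  proof (rule order_tendstoI)
    fix l assume "l < (SUP x\<in>{a<..}. f x)"
    then obtain b where b: "a < b" "l < f b" by (auto simp: less_SUP_iff)
    then show "\<forall>\<^sub>F x in at_right a. l < f x"
      unfolding eventually_at_right_field using assms by (meson less_le_trans less_imp_le)
  next
    fix u assume "(SUP x\<in>{a<..}. f x) < u"
    then have "f x < u" if "a < x" for x
      using that by (meson SUP_upper greaterThan_iff le_less_trans)
    then show "\<forall>\<^sub>F x in at_right a. f x < u"
      unfolding eventually_at_right_field by (meson lt_ex gt_ex)
  qed
qed simp

text \<open>The argument common to the three parts. \<open>P c\<close> stands for the property of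
  the collection with constant \<open>c\<close>, \<open>Q c\<close> for that of the mapping, and
  \<open>T\<close> for the constant defined by a limit. The first two assumptions make
  \<open>T\<close> the supremum of the constants satisfying \<open>P\<close>. The other two say that
  \<open>P\<close> and \<open>Q\<close> agree up to an arbitrarily small loss in the constant, which
  changes neither the supremum nor the existence of a positive constant.\<close>

lemma modulus_eqI:
  fixes T :: ennreal
  assumes "\<And>c. \<lbrakk>0 < c; ennreal c < T\<rbrakk> \<Longrightarrow> P c"
    and "\<And>c. \<lbrakk>0 < c; P c\<rbrakk> \<Longrightarrow> ennreal c \<le> T"
    and P_imp_Q: "\<And>c. \<lbrakk>0 < c; P c\<rbrakk> \<Longrightarrow> Q c"
    and Q_imp_P: "\<And>c c'. \<lbrakk>Q c; 0 < c'; c' < c\<rbrakk> \<Longrightarrow> P c'"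
  shows "((\<exists>c>0. P c) \<longleftrightarrow> (\<exists>c>0. Q c)) \<and> T = (SUP c\<in>{c. c > 0 \<and> Q c}. ennreal c)"
proof
  show "(\<exists>c>0. P c) \<longleftrightarrow> (\<exists>c>0. Q c)"
    using P_imp_Q Q_imp_P by (meson dense)
  show "T = (SUP c\<in>{c. c > 0 \<and> Q c}. ennreal c)"
  proof (rule antisym)
    show "T \<le> (SUP c\<in>{c. c > 0 \<and> Q c}. ennreal c)"
    proof (rule dense_le)
      fix t assume "t < T"
      \<comment> \<open>Lying strictly between, \<open>s\<close> is finite even if \<open>T\<close>
        is infinite, and positive even if \<open>t = 0\<close>. It is therefore a positive real, to
        which the assumptions on \<open>P\<close> apply.\<close>
      then obtain s where "t < s" "s < T" using dense by blast
      define c where "c = enn2real s"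
      have "s < top" "0 < s" using \<open>t < s\<close> \<open>s < T\<close> by (meson le_less_trans less_le_trans top_greatest zero_le)+
      then have "s = ennreal c" "0 < c" by (auto simp: c_def enn2real_positive_iff)
      then have "ennreal c \<le> (SUP c\<in>{c. c > 0 \<and> Q c}. ennreal c)"
        using assms(1) P_imp_Q \<open>s < T\<close> by (intro SUP_upper) auto
      then show "t \<le> (SUP c\<in>{c. c > 0 \<and> Q c}. ennreal c)"
        using \<open>t < s\<close> \<open>s = ennreal c\<close> by simp
    qed
    show "(SUP c\<in>{c. c > 0 \<and> Q c}. ennreal c) \<le> T"
    proof (rule SUP_least)
      fix c assume "c \<in> {c. c > 0 \<and> Q c}"
      then have c: "0 < c" "Q c" by auto
      show "ennreal c \<le> T"
      \<comment> \<open>Passing from \<open>Q\<close> to \<open>P\<close> costs part of the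
        constant, so \<open>c\<close> is approached from below by constants \<open>c'\<close> that
        satisfy \<open>P\<close>.\<close>
      proof (rule dense_le)
        fix t assume t: "t < ennreal c"
        then obtain s where s: "t < s" "s < ennreal c" using dense by blast
        define c' where "c' = enn2real s"
        have "s < top" using s(2) by (meson ennreal_less_top less_trans)
        moreover have "0 < s" using s(1) by (meson le_less_trans zero_le)
        ultimately have c': "s = ennreal c'" "0 < c'"
          by (auto simp: c'_def enn2real_positive_iff)
        with s(2) have "c' < c" by (simp add: ennreal_less_iff)
        with c c' Q_imp_P assms(2) have "s \<le> T" by blast
        with s(1) show "t \<le> T" by simp
      qed
    qed
  qed
qed

section \<open>The radius \<open>theta_at\<close> and regularity of the collection with a fixed
  constant\<close>

lemma le_theta_atI:
  assumes "0 \<le> r" "\<And>x. (\<And>i. norm (x i) \<le> r) \<Longrightarrow> \<exists>p. dist xb p \<le> \<rho> \<and> (\<forall>i. p + x i \<in> \<Omega> i)"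
  shows "ennreal r \<le> theta_at \<Omega> xb \<rho>"
  unfolding theta_at_def shifts_meet_cball_iff using assms by (intro SUP_upper) simp

text \<open>The supremum need not be an admissible radius itself. Below it, however, there is an
  admissible \<open>r' > r\<close>, and admissibility passes to smaller radii.\<close>

lemma less_theta_atD:
  assumes "ennreal r < theta_at \<Omega> xb \<rho>" "0 \<le> r" "\<And>i. norm (x i) \<le> r"
  shows "\<exists>p. dist xb p \<le> \<rho> \<and> (\<forall>i. p + x i \<in> \<Omega> i)"
proof -
  obtain r' where "ennreal r < ennreal r'"
    and r': "\<And>x. (\<And>i. norm (x i) \<le> r') \<Longrightarrow> \<exists>p. dist xb p \<le> \<rho> \<and> (\<forall>i. p + x i \<in> \<Omega> i)"
    using assms(1) unfolding theta_at_def shifts_meet_cball_iff by (auto simp: less_SUP_iff)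
  then have "r < r'" using assms(2) by (simp add: ennreal_less_iff)
  then show ?thesis using r' assms(3) by (meson less_imp_le order_trans)
qed

text \<open>Here and in the next two definitions the constant \<open>\<alpha>\<close> is a parameter
  and only \<open>\<delta>\<close> is quantified, so that constants, and not merely their existence,
  can be compared with those of the mapping.\<close>

definition set_semiregular_with ::
  "('m::finite \<Rightarrow> 'a::real_normed_vector set) \<Rightarrow> 'a \<Rightarrow> real \<Rightarrow> bool" where
  "set_semiregular_with \<Omega> xb \<alpha> \<longleftrightarrow>
    (\<exists>\<delta>>0. \<forall>\<rho>. 0 < \<rho> \<longrightarrow> \<rho> < \<delta> \<longrightarrow> (\<forall>x. (\<forall>i. norm (x i) \<le> \<alpha> * \<rho>) \<longrightarrow>
      (\<exists>p. dist xb p \<le> \<rho> \<and> (\<forall>i. p + x i \<in> \<Omega> i))))"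

definition set_subregular_with ::
  "('m::finite \<Rightarrow> 'a::real_normed_vector set) \<Rightarrow> 'a \<Rightarrow> real \<Rightarrow> bool" where
  "set_subregular_with \<Omega> xb \<alpha> \<longleftrightarrow>
    (\<exists>\<delta>>0. \<forall>\<rho>. 0 < \<rho> \<longrightarrow> \<rho> < \<delta> \<longrightarrow>
      (\<Inter>i. \<Omega> i + cball 0 (\<alpha> * \<rho>)) \<inter> cball xb \<delta> \<subseteq> (\<Inter>i. \<Omega> i) + cball 0 \<rho>)"

definition set_uniformly_regular_with ::
  "('m::finite \<Rightarrow> 'a::real_normed_vector set) \<Rightarrow> 'a \<Rightarrow> real \<Rightarrow> bool" where
  "set_uniformly_regular_with \<Omega> xb \<alpha> \<longleftrightarrow>
    (\<exists>\<delta>>0. \<forall>\<rho>. 0 < \<rho> \<longrightarrow> \<rho> < \<delta> \<longrightarrow> (\<forall>\<omega> x.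
      (\<forall>i. \<omega> i \<in> \<Omega> i) \<longrightarrow> (\<forall>i. dist xb (\<omega> i) \<le> \<delta>) \<longrightarrow>
      (\<forall>i. norm (x i) \<le> \<alpha> * \<rho>) \<longrightarrow> (\<exists>u. norm u \<le> \<rho> \<and> (\<forall>i. u + x i + \<omega> i \<in> \<Omega> i))))"

lemma semiregular_iff: "semiregular \<Omega> xb \<longleftrightarrow> (\<exists>\<alpha>>0. set_semiregular_with \<Omega> xb \<alpha>)"
  unfolding semiregular_def set_semiregular_with_def shifts_meet_cball_iff MAX_le_iff Ball_def
  by (simp add: imp_conjL)

lemma subregular_iff: "subregular \<Omega> xb \<longleftrightarrow> (\<exists>\<alpha>>0. set_subregular_with \<Omega> xb \<alpha>)"
  unfolding subregular_def set_subregular_with_def Ball_def by (simp add: imp_conjL)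

lemma uniformly_regular_iff:
  "uniformly_regular \<Omega> xb \<longleftrightarrow> (\<exists>\<alpha>>0. set_uniformly_regular_with \<Omega> xb \<alpha>)"
  unfolding uniformly_regular_def set_uniformly_regular_with_def shifts_meet_cball_iff MAX_le_iff
    Ball_def
  by (simp add: mem_shift_iff all_conj_distrib imp_conjL)

section \<open>Semiregularity\<close>

lemma less_theta_imp:
  assumes "0 < c" "ennreal c < theta \<Omega> xb"
  shows "set_semiregular_with \<Omega> xb c"
proof -
  have "\<forall>\<^sub>F \<rho> in at_right 0. ennreal c < theta_at \<Omega> xb \<rho> / ennreal \<rho>"
    using assms(2) unfolding theta_def by (rule less_LiminfD)
  then obtain \<delta> where "\<delta> > 0"
    and \<delta>: "\<And>\<rho>. \<lbrakk>0 < \<rho>; \<rho> < \<delta>\<rbrakk> \<Longrightarrow> ennreal c < theta_at \<Omega> xb \<rho> / ennreal \<rho>"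
    by (auto simp: eventually_at_right_field)
  then have "ennreal (c * \<rho>) < theta_at \<Omega> xb \<rho>" if "0 < \<rho>" "\<rho> < \<delta>" for \<rho>
    using that \<open>0 < c\<close> by (intro ennreal_less_divideD) auto
  then show ?thesis unfolding set_semiregular_with_def
    using \<open>0 < \<delta>\<close> \<open>0 < c\<close> by (intro exI[of _ \<delta>]) (auto intro!: less_theta_atD)
qed

lemma le_theta:
  assumes "0 < c" "set_semiregular_with \<Omega> xb c"
  shows "ennreal c \<le> theta \<Omega> xb"
proof -
  obtain \<delta> where "\<delta> > 0"
    and \<delta>: "\<And>\<rho> x. \<lbrakk>0 < \<rho>; \<rho> < \<delta>; \<And>i. norm (x i) \<le> c * \<rho>\<rbrakk> \<Longrightarrow>
      \<exists>p. dist xb p \<le> \<rho> \<and> (\<forall>i. p + x i \<in> \<Omega> i)"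
    using assms(2) unfolding set_semiregular_with_def by blast
  have "ennreal c \<le> theta_at \<Omega> xb \<rho> / ennreal \<rho>" if "0 < \<rho>" "\<rho> < \<delta>" for \<rho>
    using that \<open>0 < c\<close> \<delta> by (intro ennreal_le_divideI le_theta_atI) auto
  then show ?thesis
    unfolding theta_def using \<open>0 < \<delta>\<close>
    by (intro Liminf_bounded) (auto simp: eventually_at_right_field)
qed

lemma set_semiregular_imp_semiregular:
  assumes "0 < c" "set_semiregular_with \<Omega> xb c" "xb \<in> (\<Inter>i. \<Omega> i)"
  shows "semiregular_with (shift_map \<Omega>) xb 0 c"
proof -
  obtain \<delta> where "\<delta> > 0"
    and \<delta>: "\<And>\<rho> x. \<lbrakk>0 < \<rho>; \<rho> < \<delta>; \<And>i. norm (x i) \<le> c * \<rho>\<rbrakk> \<Longrightarrow>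
      \<exists>p. dist xb p \<le> \<rho> \<and> (\<forall>i. p + x i \<in> \<Omega> i)"
    using assms(2) unfolding set_semiregular_with_def by blast
  \<comment> \<open>Halving \<open>c * \<delta>\<close> keeps \<open>norm y / c\<close>, the later
    \<open>\<rho>\<close>, strictly below \<open>\<delta>\<close> on the closed ball.\<close>
  have "ennreal c * set_dist xb (preimage (shift_map \<Omega>) y) \<le> ennreal (dist y 0)"
    if y: "y \<in> cball 0 (c * \<delta> / 2)" for y
  proof -
    have "\<exists>p. c * dist xb p \<le> norm y \<and> (\<forall>i. p + coord y i \<in> \<Omega> i)"
    \<comment> \<open>For \<open>y = 0\<close> the choice \<open>\<rho> = norm y / c\<close> would
      not be positive, but then \<open>xb\<close> itself lies in the preimage.\<close>
    proof (cases "y = 0")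
      case True
      then show ?thesis using assms(3) by (intro exI[of _ xb]) auto
    next
      case False
      define \<rho> where "\<rho> = norm y / c"
      have eq: "norm y = c * \<rho>" using \<open>0 < c\<close> by (simp add: \<rho>_def)
      moreover have "0 < \<rho>" using False \<open>0 < c\<close> by (simp add: \<rho>_def)
      moreover have "\<rho> < \<delta>"
      proof -
        have "c * \<rho> < c * \<delta>"
          using y mult_pos_pos[OF \<open>0 < c\<close> \<open>0 < \<delta>\<close>] unfolding eq[symmetric] by simp
        then show ?thesis using \<open>0 < c\<close> by simp
      qed
      ultimately obtain p where "dist xb p \<le> \<rho>" "\<forall>i. p + coord y i \<in> \<Omega> i"
        using \<delta>[of \<rho> "coord y"] norm_coord_le[of y] by auto
      then show ?thesis using eq \<open>0 < c\<close> by auto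
    qed
    then show ?thesis
      using \<open>0 < c\<close> by (auto simp: mem_preimage_shift_map_iff intro!: mult_set_dist_leI)
  qed
  then show ?thesis unfolding semiregular_with_def
    using \<open>0 < c\<close> \<open>0 < \<delta>\<close> by (intro exI[of _ "c * \<delta> / 2"]) auto
qed

lemma semiregular_imp_set_semiregular:
  assumes "semiregular_with (shift_map \<Omega>) xb 0 c" "0 < c'" "c' < c"
  shows "set_semiregular_with \<Omega> xb c'"
proof -
  obtain \<delta> where "\<delta> > 0" and \<delta>: "\<And>y. norm y \<le> \<delta> \<Longrightarrow>
      ennreal c * set_dist xb (preimage (shift_map \<Omega>) y) \<le> ennreal (norm y)"
    using assms(1) unfolding semiregular_with_def by auto
  \<comment> \<open>The bound \<open>\<delta> / c'\<close> on \<open>\<rho>\<close> puts every tuple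
    of norm at most \<open>c' * \<rho>\<close> into the ball of radius \<open>\<delta>\<close> on
    which the mapping is controlled.\<close>
  have "\<exists>p. dist xb p \<le> \<rho> \<and> (\<forall>i. p + x i \<in> \<Omega> i)"
    if \<rho>: "0 < \<rho>" "\<rho> < \<delta> / c'" and x: "\<And>i. norm (x i) \<le> c' * \<rho>" for \<rho> x
  proof -
    have "norm (tuple x) \<le> c' * \<rho>" using x by (simp add: norm_max_pow_le_iff)
    moreover have "c' * \<rho> \<le> \<delta>" using \<rho> assms(2) by (simp add: field_simps)
    ultimately have "ennreal c * set_dist xb (preimage (shift_map \<Omega>) (tuple x)) \<le> ennreal (c' * \<rho>)"
      using \<delta>[of "tuple x"] by (meson ennreal_leI order_trans)
    then obtain p where "p \<in> preimage (shift_map \<Omega>) (tuple x)" "dist xb p \<le> \<rho>"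
      using mult_set_dist_leE[OF _ assms(2,3) \<rho>(1)] by blast
    then show ?thesis by (auto simp: mem_preimage_shift_map_iff)
  qed
  then show ?thesis unfolding set_semiregular_with_def
    using \<open>0 < \<delta>\<close> assms(2) by (intro exI[of _ "\<delta> / c'"]) auto
qed

section \<open>Subregularity\<close>

lemma zeta_at_antimono: "\<delta> \<le> \<delta>' \<Longrightarrow> zeta_at \<Omega> xb \<rho> \<delta>' \<le> zeta_at \<Omega> xb \<rho> \<delta>"
  unfolding zeta_at_def by (rule SUP_subset_mono) (auto simp: subset_iff)

text \<open>As \<open>\<delta>\<close> shrinks, the infimum runs over fewer \<open>\<rho>\<close>
  and the inclusion in \<open>zeta_at\<close> is required on a smaller ball. The expression under
  the limit therefore grows.\<close>

lemma zeta_eq_SUP: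
  "zeta \<Omega> xb = (SUP \<delta>\<in>{0<..}. INF \<rho>\<in>{0<..<\<delta>}. zeta_at \<Omega> xb \<rho> \<delta> / ennreal \<rho>)"
  unfolding zeta_def
  by (rule Lim_at_right_antimono)
    (intro INF_superset_mono divide_right_mono_ennreal zeta_at_antimono; auto)

lemma less_zeta_imp:
  assumes "0 < c" "ennreal c < zeta \<Omega> xb"
  shows "set_subregular_with \<Omega> xb c"
proof -
  \<comment> \<open>The supremum form yields one \<open>\<delta>\<close> that is both the bound on
    \<open>\<rho>\<close> and the radius of the ball, exactly as \<open>set_subregular_with\<close>
    requires.\<close>
  obtain \<delta> where "\<delta> > 0"
    and \<delta>: "ennreal c < (INF \<rho>\<in>{0<..<\<delta>}. zeta_at \<Omega> xb \<rho> \<delta> / ennreal \<rho>)"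
    using assms(2) unfolding zeta_eq_SUP less_SUP_iff by auto
  have sub: "(\<Inter>i. \<Omega> i + cball 0 (c * \<rho>)) \<inter> cball xb \<delta> \<subseteq> (\<Inter>i. \<Omega> i) + cball 0 \<rho>"
    if "0 < \<rho>" "\<rho> < \<delta>" for \<rho>
  proof -
    have "ennreal c < zeta_at \<Omega> xb \<rho> \<delta> / ennreal \<rho>"
      using \<delta> that by (auto dest: less_INF_D)
    then have "ennreal (c * \<rho>) < zeta_at \<Omega> xb \<rho> \<delta>"
      using that \<open>0 < c\<close> by (intro ennreal_less_divideD) auto
    then obtain r where "ennreal (c * \<rho>) < ennreal r"
      and r: "(\<Inter>i. \<Omega> i + cball 0 r) \<inter> cball xb \<delta> \<subseteq> (\<Inter>i. \<Omega> i) + cball 0 \<rho>"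
      unfolding zeta_at_def less_SUP_iff by auto
    \<comment> \<open>Enlargements grow with the radius, so the inclusion for the admissible
      \<open>r\<close> implies the one for \<open>c * \<rho>\<close>.\<close>
    then have "c * \<rho> \<le> r" using that \<open>0 < c\<close> by (simp add: ennreal_less_iff)
    then have "\<Omega> i + cball 0 (c * \<rho>) \<subseteq> \<Omega> i + cball 0 r" for i
      by (intro set_plus_mono2) auto
    then have "(\<Inter>i. \<Omega> i + cball 0 (c * \<rho>)) \<inter> cball xb \<delta> \<subseteq> (\<Inter>i. \<Omega> i + cball 0 r) \<inter> cball xb \<delta>"
      by (intro Int_mono INF_mono') auto
    then show ?thesis using r by (rule order_trans)
  qed
  show ?thesis unfolding set_subregular_with_def
    by (rule exI[of _ \<delta>]) (simp add: sub \<open>0 < \<delta>\<close>)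
qed

lemma le_zeta:
  assumes "0 < c" "set_subregular_with \<Omega> xb c"
  shows "ennreal c \<le> zeta \<Omega> xb"
proof -
  obtain \<delta> where "\<delta> > 0"
    and \<delta>: "\<And>\<rho>. \<lbrakk>0 < \<rho>; \<rho> < \<delta>\<rbrakk> \<Longrightarrow>
      (\<Inter>i. \<Omega> i + cball 0 (c * \<rho>)) \<inter> cball xb \<delta> \<subseteq> (\<Inter>i. \<Omega> i) + cball 0 \<rho>"
    using assms(2) unfolding set_subregular_with_def by blast
  have "ennreal c \<le> (INF \<rho>\<in>{0<..<\<delta>}. zeta_at \<Omega> xb \<rho> \<delta> / ennreal \<rho>)"
  proof (rule INF_greatest)
    fix \<rho> assume "\<rho> \<in> {0<..<\<delta>}"
    then have \<rho>: "0 < \<rho>" "\<rho> < \<delta>" by auto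
    then have "ennreal (c * \<rho>) \<le> zeta_at \<Omega> xb \<rho> \<delta>"
      unfolding zeta_at_def using \<open>0 < c\<close> \<delta> by (intro SUP_upper) simp
    then show "ennreal c \<le> zeta_at \<Omega> xb \<rho> \<delta> / ennreal \<rho>"
      using \<rho> \<open>0 < c\<close> by (intro ennreal_le_divideI) auto
  qed
  then show ?thesis unfolding zeta_eq_SUP
    using \<open>0 < \<delta>\<close> by (intro SUP_upper2[of \<delta>]) auto
qed

lemma set_subregular_imp_subregular:
  assumes "0 < c" "set_subregular_with \<Omega> xb c" "xb \<in> (\<Inter>i. \<Omega> i)"
  shows "subregular_with (shift_map \<Omega>) xb 0 c"
proof -
  obtain \<delta> where "\<delta> > 0"
    and \<delta>: "\<And>\<rho>. \<lbrakk>0 < \<rho>; \<rho> < \<delta>\<rbrakk> \<Longrightarrow>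
      (\<Inter>i. \<Omega> i + cball 0 (c * \<rho>)) \<inter> cball xb \<delta> \<subseteq> (\<Inter>i. \<Omega> i) + cball 0 \<rho>"
    using assms(2) unfolding set_subregular_with_def by blast
  have "ennreal c * set_dist x (preimage (shift_map \<Omega>) 0) \<le> set_dist 0 (shift_map \<Omega> x)"
    if x: "x \<in> cball xb \<delta>" for x
    unfolding set_dist_def[of 0]
  proof (rule INF_greatest)
    fix y assume "y \<in> shift_map \<Omega> x"
    then have y: "x + coord y i \<in> \<Omega> i" for i by (simp add: mem_shift_map_iff)
    \<comment> \<open>Only the middle case gives an admissible \<open>\<rho> = norm y / c\<close>.
      For \<open>y = 0\<close> the point \<open>x\<close> already lies in all the sets. For large
      \<open>y\<close> the point \<open>xb\<close> is close enough, because
      \<open>c * dist x xb \<le> c * \<delta>\<close>.\<close>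
    consider "y = 0" | "y \<noteq> 0" "norm y < c * \<delta>" | "c * \<delta> \<le> norm y" by linarith
    then have "\<exists>a\<in>\<Inter>i. \<Omega> i. c * dist x a \<le> norm y"
    proof cases
      case 1
      then show ?thesis using y by (intro bexI[of _ x]) auto
    next
      case 2
      define \<rho> where "\<rho> = norm y / c"
      have eq: "norm y = c * \<rho>" using \<open>0 < c\<close> by (simp add: \<rho>_def)
      have \<rho>: "0 < \<rho>" "\<rho> < \<delta>" using 2 \<open>0 < c\<close> by (auto simp: \<rho>_def field_simps)
      have "dist x (x + coord y i) \<le> c * \<rho>" for i
        using norm_coord_le[of y i] by (simp add: dist_norm eq)
      then have "x \<in> (\<Inter>i. \<Omega> i + cball 0 (c * \<rho>)) \<inter> cball xb \<delta>"
        using x y unfolding mem_plus_cball_iff Int_iff INT_iff by blast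
      then have "x \<in> (\<Inter>i. \<Omega> i) + cball 0 \<rho>" by (rule subsetD[OF \<delta>[OF \<rho>]])
      then obtain a where "a \<in> (\<Inter>i. \<Omega> i)" "dist x a \<le> \<rho>"
        unfolding mem_plus_cball_iff by blast
      then show ?thesis using eq \<open>0 < c\<close> by auto
    next
      case 3
      have "c * dist x xb \<le> c * \<delta>" using x \<open>0 < c\<close> by (simp add: dist_commute)
      then show ?thesis using 3 assms(3) by (intro bexI[of _ xb]) auto
    qed
    then show "ennreal c * set_dist x (preimage (shift_map \<Omega>) 0) \<le> ennreal (dist 0 y)"
      using \<open>0 < c\<close> by (auto simp: mem_preimage_shift_map_iff intro!: mult_set_dist_leI)
  qed
  then show ?thesis unfolding subregular_with_def using \<open>0 < \<delta>\<close> by blast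
qed

lemma subregular_imp_set_subregular:
  assumes "subregular_with (shift_map \<Omega>) xb 0 c" "0 < c'" "c' < c"
  shows "set_subregular_with \<Omega> xb c'"
proof -
  obtain \<delta> where "\<delta> > 0" and \<delta>: "\<And>x. x \<in> cball xb \<delta> \<Longrightarrow>
      ennreal c * set_dist x (preimage (shift_map \<Omega>) 0) \<le> set_dist 0 (shift_map \<Omega> x)"
    using assms(1) unfolding subregular_with_def by auto
  have "x \<in> (\<Inter>i. \<Omega> i) + cball 0 \<rho>"
    if \<rho>: "0 < \<rho>" and x: "x \<in> cball xb \<delta>" and near: "\<forall>i. x \<in> \<Omega> i + cball 0 (c' * \<rho>)" for \<rho> x
  proof -
    obtain w where w: "\<And>i. w i \<in> \<Omega> i" "\<And>i. dist x (w i) \<le> c' * \<rho>"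
      using near unfolding mem_plus_cball_iff by metis
    \<comment> \<open>Seen from \<open>x\<close>, the nearby points \<open>w i\<close> form an
      element of the value of the mapping at \<open>x\<close>, which bounds the distance from 0 to
      that value by \<open>c' * \<rho>\<close>.\<close>
    define y where "y = tuple (\<lambda>i. w i - x)"
    have "y \<in> shift_map \<Omega> x" using w by (simp add: y_def mem_shift_map_iff)
    then have "set_dist 0 (shift_map \<Omega> x) \<le> ennreal (dist 0 y)"
      unfolding set_dist_def by (rule INF_lower)
    also have "norm y \<le> c' * \<rho>"
      using w by (simp add: y_def norm_max_pow_le_iff dist_norm norm_minus_commute)
    then have "ennreal (dist 0 y) \<le> ennreal (c' * \<rho>)" by (simp add: ennreal_leI)
    finally have "ennreal c * set_dist x (preimage (shift_map \<Omega>) 0) \<le> ennreal (c' * \<rho>)"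
      using \<delta>[OF x] by (rule order_trans[rotated])
    then obtain a where "a \<in> preimage (shift_map \<Omega>) 0" "dist x a \<le> \<rho>"
      using mult_set_dist_leE[OF _ assms(2,3) \<rho>] by blast
    then show ?thesis by (auto simp: mem_plus_cball_iff mem_preimage_shift_map_iff)
  qed
  then show ?thesis unfolding set_subregular_with_def
    using \<open>0 < \<delta>\<close> by (intro exI[of _ \<delta>]) auto
qed

section \<open>Uniform regularity\<close>

lemma less_theta_hat_imp:
  assumes "0 < c" "ennreal c < theta_hat \<Omega> xb"
  shows "set_uniformly_regular_with \<Omega> xb c"
proof -
  let ?F = "inf (nhds (tuple (\<lambda>_. xb))) (principal {\<omega>. \<forall>i. coord \<omega> i \<in> \<Omega> i})"
  have "\<forall>\<^sub>F (\<omega>, \<rho>) in ?F \<times>\<^sub>F at_right 0.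
      ennreal c < theta_at (\<lambda>i. shift (\<Omega> i) (coord \<omega> i)) 0 \<rho> / ennreal \<rho>"
    using less_LiminfD[OF assms(2)[unfolded theta_hat_def]] by (simp add: case_prod_unfold)
  then obtain P Q where P: "eventually P ?F" and Q: "eventually Q (at_right 0)"
    and PQ: "\<And>\<omega> \<rho>. \<lbrakk>P \<omega>; Q \<rho>\<rbrakk> \<Longrightarrow>
      ennreal c < theta_at (\<lambda>i. shift (\<Omega> i) (coord \<omega> i)) 0 \<rho> / ennreal \<rho>"
    by (auto simp: eventually_prod_filter)
  obtain d where "d > 0"
    and d: "\<And>\<omega>. \<lbrakk>dist \<omega> (tuple (\<lambda>_. xb)) < d; \<forall>i. coord \<omega> i \<in> \<Omega> i\<rbrakk> \<Longrightarrow> P \<omega>"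
    using P by (auto simp: eventually_inf_principal eventually_nhds_metric)
  obtain e where "e > 0" and e: "\<And>\<rho>. \<lbrakk>0 < \<rho>; \<rho> < e\<rbrakk> \<Longrightarrow> Q \<rho>"
    using Q by (auto simp: eventually_at_right_field)
  \<comment> \<open>A single number must bound both \<open>\<rho>\<close> and the distances of the
    \<open>\<omega> i\<close> from \<open>xb\<close>, hence the minimum. The half is taken because
    those distances may attain the bound, while the filter provides an open ball of radius
    \<open>d\<close>.\<close>
  have "\<exists>u. norm u \<le> \<rho> \<and> (\<forall>i. u + x i + \<omega> i \<in> \<Omega> i)"
    if \<rho>: "0 < \<rho>" "\<rho> < min (d / 2) e"
      and \<omega>: "\<And>i. \<omega> i \<in> \<Omega> i" "\<And>i. dist xb (\<omega> i) \<le> min (d / 2) e"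
      and x: "\<And>i. norm (x i) \<le> c * \<rho>" for \<rho> \<omega> x
  proof -
    have "norm (tuple \<omega> - tuple (\<lambda>_. xb)) \<le> d / 2"
      unfolding norm_max_pow_le_iff using \<omega>(2) by (simp add: dist_norm norm_minus_commute)
    then have "P (tuple \<omega>)"
      using \<omega>(1) \<open>d > 0\<close> by (intro d) (simp_all add: dist_norm)
    then have "ennreal c < theta_at (\<lambda>i. shift (\<Omega> i) (\<omega> i)) 0 \<rho> / ennreal \<rho>"
      using PQ[of "tuple \<omega>" \<rho>] e \<rho> by simp
    then have "ennreal (c * \<rho>) < theta_at (\<lambda>i. shift (\<Omega> i) (\<omega> i)) 0 \<rho>"
      using \<rho> \<open>0 < c\<close> by (intro ennreal_less_divideD) auto
    from less_theta_atD[OF this _ x] show ?thesis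
      using \<rho> \<open>0 < c\<close> by (simp add: mem_shift_iff)
  qed
  then show ?thesis unfolding set_uniformly_regular_with_def
    using \<open>d > 0\<close> \<open>e > 0\<close> by (intro exI[of _ "min (d / 2) e"]) auto
qed

lemma le_theta_hat:
  fixes \<Omega> :: "'m::finite \<Rightarrow> 'a::real_normed_vector set"
  assumes "0 < c" "set_uniformly_regular_with \<Omega> xb c"
  shows "ennreal c \<le> theta_hat \<Omega> xb"
proof -
  obtain \<delta> where "\<delta> > 0"
    and \<delta>: "\<And>\<rho> \<omega> x. \<lbrakk>0 < \<rho>; \<rho> < \<delta>; \<And>i. \<omega> i \<in> \<Omega> i; \<And>i. dist xb (\<omega> i) \<le> \<delta>;
      \<And>i. norm (x i) \<le> c * \<rho>\<rbrakk> \<Longrightarrow> \<exists>u. norm u \<le> \<rho> \<and> (\<forall>i. u + x i + \<omega> i \<in> \<Omega> i)"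
    using assms(2) unfolding set_uniformly_regular_with_def by blast
  let ?F = "inf (nhds (tuple (\<lambda>_. xb))) (principal {\<omega>. \<forall>i. coord \<omega> i \<in> \<Omega> i})"
  let ?near = "\<lambda>\<omega>. (\<forall>i. coord \<omega> i \<in> \<Omega> i) \<and> (\<forall>i. dist xb (coord \<omega> i) \<le> \<delta>)"
  \<comment> \<open>The maximum norm dominates each coordinate, so a neighbourhood of the constant
    tuple controls all base points at once.\<close>
  have "dist xb (coord \<omega> i) \<le> \<delta>" if "dist \<omega> (tuple (\<lambda>_. xb)) < \<delta>" for \<omega> :: "('a, 'm) max_pow" and i
    using that norm_coord_le[of "\<omega> - tuple (\<lambda>_. xb)" i] by (simp add: dist_norm norm_minus_commute)
  then have near: "eventually ?near ?F"
    unfolding eventually_inf_principal eventually_nhds_metric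
    using \<open>\<delta> > 0\<close> by (intro exI[of _ \<delta>]) auto
  have small: "\<forall>\<^sub>F \<rho> in at_right 0. 0 < \<rho> \<and> \<rho> < \<delta>"
    using \<open>\<delta> > 0\<close> by (auto simp: eventually_at_right_field)
  have bound: "ennreal c \<le> theta_at (\<lambda>i. shift (\<Omega> i) (coord \<omega> i)) 0 \<rho> / ennreal \<rho>"
    if "?near \<omega>" "0 < \<rho> \<and> \<rho> < \<delta>" for \<omega> \<rho>
    using that \<open>0 < c\<close> \<delta>[of \<rho> "coord \<omega>"]
    by (intro ennreal_le_divideI le_theta_atI) (auto simp: mem_shift_iff)
  have "\<forall>\<^sub>F p in ?F \<times>\<^sub>F at_right 0.
      ennreal c \<le> (\<lambda>(\<omega>, \<rho>). theta_at (\<lambda>i. shift (\<Omega> i) (coord \<omega> i)) 0 \<rho> / ennreal \<rho>) p"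
    unfolding eventually_prod_filter
    by (intro exI[of _ ?near] exI[of _ "\<lambda>\<rho>. 0 < \<rho> \<and> \<rho> < \<delta>"] conjI near small)
      (use bound in auto)
  then show ?thesis unfolding theta_hat_def by (rule Liminf_bounded)
qed

text \<open>For \<open>z\<close> in the value at \<open>x\<close>, the base points
  \<open>x + coord z i\<close> and the perturbations \<open>coord (y - z) i\<close> add up to
  \<open>x + coord y i\<close>. Uniform regularity then moves \<open>x\<close> by some
  \<open>u\<close> of norm at most \<open>norm (y - z) / c\<close> into the preimage of
  \<open>y\<close>. The base points are near \<open>xb\<close> only if \<open>y - z\<close> is
  small; for large \<open>y - z\<close> a bound on \<open>u\<close> independent of \<open>z\<close>
  suffices.\<close>

lemma set_uniformly_regular_imp_regular:
  assumes "0 < c" "set_uniformly_regular_with \<Omega> xb c" "xb \<in> (\<Inter>i. \<Omega> i)"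
  shows "regular_with (shift_map \<Omega>) xb 0 c"
proof -
  obtain \<delta> where "\<delta> > 0"
    and \<delta>: "\<And>\<rho> \<omega> x. \<lbrakk>0 < \<rho>; \<rho> < \<delta>; \<And>i. \<omega> i \<in> \<Omega> i; \<And>i. dist xb (\<omega> i) \<le> \<delta>;
      \<And>i. norm (x i) \<le> c * \<rho>\<rbrakk> \<Longrightarrow> \<exists>u. norm u \<le> \<rho> \<and> (\<forall>i. u + x i + \<omega> i \<in> \<Omega> i)"
    using assms(2) unfolding set_uniformly_regular_with_def by blast
  \<comment> \<open>The bound \<open>4 * \<epsilon> \<le> \<delta>\<close> keeps the base points
    within \<open>\<delta>\<close> of \<open>xb\<close>: \<open>\<epsilon>\<close> accounts for
    \<open>x - xb\<close> and \<open>3 * \<epsilon>\<close> for \<open>z\<close>. The bound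
    \<open>2 * \<epsilon> < c * \<delta>\<close> makes \<open>\<rho> < \<delta>\<close> in both
    cases that use uniform regularity.\<close>
  define \<epsilon> where "\<epsilon> = min (\<delta> / 4) (c * \<delta> / 4)"
  have \<epsilon>: "0 < \<epsilon>" "4 * \<epsilon> \<le> \<delta>" "2 * \<epsilon> < c * \<delta>"
    using \<open>0 < c\<close> \<open>0 < \<delta>\<close> mult_pos_pos[of c \<delta>] by (auto simp: \<epsilon>_def min_def)
  have "ennreal c * set_dist x (preimage (shift_map \<Omega>) y) \<le> set_dist y (shift_map \<Omega> x)"
    if x: "x \<in> cball xb \<epsilon>" and y: "y \<in> cball 0 \<epsilon>" for x y
    unfolding set_dist_def[of y]
  proof (rule INF_greatest)
    fix z assume "z \<in> shift_map \<Omega> x"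
    then have z: "x + coord z i \<in> \<Omega> i" for i by (simp add: mem_shift_map_iff)
    have nx: "norm (x - xb) \<le> \<epsilon>" and ny: "norm y \<le> \<epsilon>"
      using x y by (simp_all add: dist_norm norm_minus_commute)
    consider "y = z" | "y \<noteq> z" "norm (y - z) < 2 * \<epsilon>" | "2 * \<epsilon> \<le> norm (y - z)" by linarith
    then have "\<exists>u. c * norm u \<le> norm (y - z) \<and> (\<forall>i. x + u + coord y i \<in> \<Omega> i)"
    proof cases
      case 1
      then show ?thesis using z by (intro exI[of _ 0]) simp
    next
      case 2
      define \<rho> where "\<rho> = norm (y - z) / c"
      have eq: "norm (y - z) = c * \<rho>" using \<open>0 < c\<close> by (simp add: \<rho>_def)
      have "c * \<rho> < c * \<delta>" using 2 \<epsilon>(3) by (simp flip: eq)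
      then have "\<rho> < \<delta>" using \<open>0 < c\<close> by simp
      moreover have "0 < \<rho>" using 2(1) \<open>0 < c\<close> by (simp add: \<rho>_def)
      ultimately have \<rho>: "0 < \<rho>" "\<rho> < \<delta>" by auto
      have "norm z \<le> 3 * \<epsilon>"
        using norm_triangle_ineq4[of y "y - z"] ny 2 by simp
      then have "dist xb (x + coord z i) \<le> \<delta>" for i
        using norm_triangle_ineq[of "x - xb" "coord z i"] nx norm_coord_le[of z i] \<epsilon>(2)
        by (simp add: dist_norm norm_minus_commute algebra_simps)
      moreover have "norm (coord (y - z) i) \<le> c * \<rho>" for i
        using norm_coord_le[of "y - z" i] by (simp add: eq)
      ultimately obtain u where "norm u \<le> \<rho>"
        "\<forall>i. u + coord (y - z) i + (x + coord z i) \<in> \<Omega> i"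
        using \<delta>[of \<rho> "\<lambda>i. x + coord z i" "coord (y - z)"] \<rho> z by blast
      then show ?thesis
        using eq \<open>0 < c\<close> by (intro exI[of _ u]) (simp add: algebra_simps)
    next
      \<comment> \<open>Here \<open>x + z\<^sub>i\<close> may be far from \<open>xb\<close>, so the base points are \<open>\<omega>\<^sub>i = xb\<close> instead.\<close>
      case 3
      define \<rho> where "\<rho> = 2 * \<epsilon> / c"
      have eq: "2 * \<epsilon> = c * \<rho>" using \<open>0 < c\<close> by (simp add: \<rho>_def)
      have \<rho>: "0 < \<rho>" "\<rho> < \<delta>" using \<epsilon> \<open>0 < c\<close> by (simp_all add: \<rho>_def field_simps)
      have "norm (coord y i + (x - xb)) \<le> c * \<rho>" for i
        using norm_triangle_ineq[of "coord y i" "x - xb"] nx ny norm_coord_le[of y i] eq by linarith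
      then obtain u where "norm u \<le> \<rho>" "\<forall>i. u + (coord y i + (x - xb)) + xb \<in> \<Omega> i"
        using \<delta>[of \<rho> "\<lambda>_. xb" "\<lambda>i. coord y i + (x - xb)"] \<rho> assms(3) \<open>0 < \<delta>\<close> by auto
      moreover from this have "c * norm u \<le> norm (y - z)"
        using 3 eq \<open>0 < c\<close> by (metis mult_left_mono less_imp_le order_trans)
      ultimately show ?thesis by (intro exI[of _ u]) (simp add: algebra_simps)
    qed
    then obtain u where "c * norm u \<le> norm (y - z)" "x + u \<in> preimage (shift_map \<Omega>) y"
      unfolding mem_preimage_shift_map_iff by blast
    then show "ennreal c * set_dist x (preimage (shift_map \<Omega>) y) \<le> ennreal (dist y z)"
      using \<open>0 < c\<close> by (intro mult_set_dist_leI[of c "x + u"]) (simp_all add: dist_norm)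
  qed
  then show ?thesis unfolding regular_with_def using \<epsilon>(1) by blast
qed

text \<open>The base points are absorbed into the second argument of the regularity estimate, taken
  at \<open>xb\<close>: the differences \<open>\<omega> i - xb\<close> form a point \<open>z\<close>
  of the value at \<open>xb\<close>, and adding the perturbations \<open>x i\<close> gives a
  \<open>y\<close> with \<open>dist y z \<le> c' * \<rho>\<close>.\<close>

lemma regular_imp_set_uniformly_regular:
  assumes "regular_with (shift_map \<Omega>) xb 0 c" "0 < c'" "c' < c"
  shows "set_uniformly_regular_with \<Omega> xb c'"
proof -
  obtain \<delta> where "\<delta> > 0" and \<delta>: "\<And>x y. \<lbrakk>x \<in> cball xb \<delta>; y \<in> cball 0 \<delta>\<rbrakk> \<Longrightarrow>
      ennreal c * set_dist x (preimage (shift_map \<Omega>) y) \<le> set_dist y (shift_map \<Omega> x)"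
    using assms(1) unfolding regular_with_def by auto
  \<comment> \<open>Chosen so that \<open>\<epsilon> + c' * \<epsilon> = \<delta>\<close>: the
    differences \<open>\<omega> i - xb\<close> contribute at most \<open>\<epsilon>\<close> to the
    norm of \<open>y\<close> and the perturbations at most \<open>c' * \<epsilon>\<close>.\<close>
  define \<epsilon> where "\<epsilon> = \<delta> / (1 + c')"
  have "0 < \<epsilon>" using \<open>0 < \<delta>\<close> assms(2) by (simp add: \<epsilon>_def)
  moreover have "\<epsilon> * (1 + c') = \<delta>" using assms(2) by (simp add: \<epsilon>_def)
  ultimately have \<epsilon>: "0 < \<epsilon>" "\<epsilon> + c' * \<epsilon> = \<delta>" by (simp_all add: algebra_simps)
  have "\<exists>u. norm u \<le> \<rho> \<and> (\<forall>i. u + x i + \<omega> i \<in> \<Omega> i)"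
    if \<rho>: "0 < \<rho>" "\<rho> < \<epsilon>" and \<omega>: "\<And>i. \<omega> i \<in> \<Omega> i" "\<And>i. dist xb (\<omega> i) \<le> \<epsilon>"
      and x: "\<And>i. norm (x i) \<le> c' * \<rho>" for \<rho> \<omega> x
  proof -
    define y where "y = tuple (\<lambda>i. x i + (\<omega> i - xb))"
    define z where "z = tuple (\<lambda>i. \<omega> i - xb)"
    have "c' * \<rho> \<le> c' * \<epsilon>" using \<rho> assms(2) by simp
    then have "norm (x i + (\<omega> i - xb)) \<le> \<delta>" for i
      using norm_triangle_ineq[of "x i" "\<omega> i - xb"] x[of i] \<omega>(2)[of i] \<epsilon>(2)
      by (simp add: dist_norm norm_minus_commute)
    then have "y \<in> cball 0 \<delta>" by (simp add: y_def norm_max_pow_le_iff)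
    then have "ennreal c * set_dist xb (preimage (shift_map \<Omega>) y) \<le> set_dist y (shift_map \<Omega> xb)"
      using \<open>0 < \<delta>\<close> by (intro \<delta>) simp_all
    also have "z \<in> shift_map \<Omega> xb" using \<omega> by (simp add: z_def mem_shift_map_iff)
    then have "set_dist y (shift_map \<Omega> xb) \<le> ennreal (dist y z)"
      unfolding set_dist_def by (rule INF_lower)
    also have "dist y z \<le> c' * \<rho>"
      unfolding dist_norm norm_max_pow_le_iff using x by (simp add: y_def z_def)
    then have "ennreal (dist y z) \<le> ennreal (c' * \<rho>)" by (rule ennreal_leI)
    finally obtain p where "p \<in> preimage (shift_map \<Omega>) y" "dist xb p \<le> \<rho>"
      using mult_set_dist_leE[OF _ assms(2,3) \<rho>(1)] by blast
    \<comment> \<open>With \<open>u = p - xb\<close> the two occurrences of \<open>xb\<close>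
      cancel, and \<open>p + coord y i\<close> equals \<open>u + x i + \<omega> i\<close>.\<close>
    then show ?thesis
      by (intro exI[of _ "p - xb"])
        (simp add: mem_preimage_shift_map_iff y_def dist_norm norm_minus_commute algebra_simps)
  qed
  then show ?thesis unfolding set_uniformly_regular_with_def
    using \<epsilon>(1) by (intro exI[of _ \<epsilon>]) auto
qed

theorem proposition5p1:
  fixes \<Omega> :: "'m::finite \<Rightarrow> 'a::real_normed_vector set" and xb :: 'a
  assumes "CARD('m) \<ge> 2" and "xb \<in> (\<Inter>i. \<Omega> i)"
  shows
    "((semiregular \<Omega> xb \<longleftrightarrow> metrically_semiregular (shift_map \<Omega>) xb 0) \<and>
        theta \<Omega> xb = semiregularity_modulus (shift_map \<Omega>) xb 0) \<and>
     ((subregular \<Omega> xb \<longleftrightarrow> metrically_subregular (shift_map \<Omega>) xb 0) \<and>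
        zeta \<Omega> xb = subregularity_modulus (shift_map \<Omega>) xb 0) \<and>
     ((uniformly_regular \<Omega> xb \<longleftrightarrow> metrically_regular (shift_map \<Omega>) xb 0) \<and>
        theta_hat \<Omega> xb = regularity_modulus (shift_map \<Omega>) xb 0)"
proof (intro conjI[OF _ conjI])
  show "(semiregular \<Omega> xb \<longleftrightarrow> metrically_semiregular (shift_map \<Omega>) xb 0) \<and>
      theta \<Omega> xb = semiregularity_modulus (shift_map \<Omega>) xb 0"
    unfolding semiregular_iff metrically_semiregular_def semiregularity_modulus_def
    using less_theta_imp le_theta set_semiregular_imp_semiregular[OF _ _ assms(2)]
      semiregular_imp_set_semiregular
    by (rule modulus_eqI)
  show "(subregular \<Omega> xb \<longleftrightarrow> metrically_subregular (shift_map \<Omega>) xb 0) \<and>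
      zeta \<Omega> xb = subregularity_modulus (shift_map \<Omega>) xb 0"
    unfolding subregular_iff metrically_subregular_def subregularity_modulus_def
    using less_zeta_imp le_zeta set_subregular_imp_subregular[OF _ _ assms(2)]
      subregular_imp_set_subregular
    by (rule modulus_eqI)
  show "(uniformly_regular \<Omega> xb \<longleftrightarrow> metrically_regular (shift_map \<Omega>) xb 0) \<and>
      theta_hat \<Omega> xb = regularity_modulus (shift_map \<Omega>) xb 0"
    unfolding uniformly_regular_iff metrically_regular_def regularity_modulus_def
    using less_theta_hat_imp le_theta_hat set_uniformly_regular_imp_regular[OF _ _ assms(2)]
      regular_imp_set_uniformly_regular
    by (rule modulus_eqI)
qed

end
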